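(* Assume that for every extreme point $\alpha_{\mathrm{ext}}$ of $\mathcal{A}$ a solution $\pi_*(\alpha_{\mathrm{ext}})$ of the high-fidelity problem $(P_{\alpha_{\mathrm{ext}}})$ belongs to $\mathcal{W}_+$, and that $\mathbf{1}_{\mathcal{N}_x}$ is one of the columns of $\widehat{U}$ or $\mathbf{1}_{\mathcal{N}_y}$ is one of the columns of $\widehat{V}$. Then for every $\alpha\in\mathcal{A}$ the reduced-order primal problem $(RP_\alpha)$ has a solution (i.e. its infimum is attained).
   Context: Let $\mathcal{N}_x,\mathcal{N}_y,K_x,K_y\ge 1$ be integers, $X=\{x_1,\dots,x_{\mathcal{N}_x}\}$, $Y=\{y_1,\dots,y_{\mathcal{N}_y}\}$ finite sets, $c:X\times Y\to\mathbb{R}_+$ a cost function and $C=(C_{ij})$, $C_{ij}=c(x_i,y_j)$, the cost matrix. Let $\mu_1,\dots,\mu_{K_x}\in\mathbb{R}_+^{\mathcal{N}_x}$ and $\nu_1,\dots,\nu_{K_y}\in\mathbb{R}_+^{\mathcal{N}_y}$ be probability vectors (nonnegative entries summing to $1$). The parameter set is $$\mathcal{A}=\Big\{\alpha=(\alpha^x,\alpha^y)\in\mathbb{R}_+^{K_x+K_y}:\ \sum_{k=1}^{K_x}\alpha^x_k=1,\ \sum_{l=1}^{K_y}\alpha^y_l=1\Big\},$$ and $\mu(\alpha)=\sum_k\alpha^x_k\mu_k$, $\nu(\alpha)=\sum_l\alpha^y_l\nu_l$. A matrix $\Pi\in\mathbb{R}^{\mathcal{N}_x\times\mathcal{N}_y}$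 is identified with the vector $\pi\in\mathbb{R}^{\mathcal{N}_x\mathcal{N}_y}$ obtained by stacking columns, $\pi_{i+(j-1)\mathcal{N}_x}=\Pi_{ij}$; let $\mathbf{c}$ be the vector associated with $C$. Let $A\in\mathbb{R}^{(\mathcal{N}_x+\mathcal{N}_y)\times\mathcal{N}_x\mathcal{N}_y}$ be the marginal constraint matrix: $(A\pi)_i=\sum_{j}\Pi_{ij}$ for $1\le i\le\mathcal{N}_x$ and $(A\pi)_{\mathcal{N}_x+j}=\sum_i\Pi_{ij}$ for $1\le j\le\mathcal{N}_y$. The high-fidelity problem is $$(P_\alpha):\quad I(\alpha)=\min\Big\{\langle\pi,\mathbf{c}\rangle:\ \pi\in\mathbb{R}_+^{\mathcal{N}_x\mathcal{N}_y},\ A\pi=\begin{pmatrix}\mu(\alpha)\\ \nu(\alpha)\end{pmatrix}\Big\}.$$ Reduced objects: $\alpha_1,\dots,\alpha_R\in\mathcal{A}$ are finitely many training parameters, $\pi_*(\alpha_r)$ is a solution of $(P_{\alpha_r})$, $\widehat{W}=(\pi_*(\alpha_1)|\cdots|\pi_*(\alpha_R))$, and $\mathcal{W}_+=\{\widehat{W}p:\ p\in\mathbb{R}_+^R\}$. Let $\widehat{U}\in\mathbb{R}^{\mathcal{N}_x\times N}$, $\widehat{V}\in\mathbb{R}^{\mathcal{N}_y\times M}$, and $\widehat{S}=\begin{pmatrix}\widehat{U}&0\\0&\widehat{V}\end{pmatrix}$. The reduced-order primal problem is $$(RP_\alpha):\quad I_R(\alpha)=\inf\Big\{\langle p,\widehat{W}^T\mathbf{c}\rangle:\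 p\in\mathbb{R}_+^R,\ \widehat{S}^TA\widehat{W}p=\widehat{S}^T\begin{pmatrix}\mu(\alpha)\\ \nu(\alpha)\end{pmatrix}\Big\}.$$ $\mathbf{1}_n$ denotes the all-ones vector of $\mathbb{R}^n$. *)

theory Defs
  imports "HOL-Analysis.Analysis"
begin

text \<open>
  Dimensions are finite index types: \<open>'x\<close>, \<open>'y\<close> are the finite sets \<open>X\<close>, \<open>Y\<close>, the types
  \<open>'k\<close>, \<open>'l\<close> index the \<open>K\<^sub>x\<close>, \<open>K\<^sub>y\<close> reference measures, \<open>'r\<close> indexes the training parameters, and
  \<open>'n\<close>, \<open>'m\<close> index the columns of \<open>U\<close>, \<open>V\<close>.  The vector of a matrix in \<open>real ^ 'y ^ 'x\<close> is indexed
  by pairs in \<open>'x \<times> 'y\<close> instead of by \<open>i + (j - 1) N\<^sub>x\<close>, and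
  block vectors and matrices are indexed by sum types.
\<close>

definition nonneg_vec :: "real ^ 'n \<Rightarrow> bool" where
  "nonneg_vec v \<longleftrightarrow> (\<forall>i. 0 \<le> v $ i)"

definition prob_vec :: "real ^ 'n \<Rightarrow> bool" where
  "prob_vec v \<longleftrightarrow> nonneg_vec v \<and> (\<Sum>i\<in>UNIV. v $ i) = 1"

definition param_set :: "((real ^ 'k) \<times> (real ^ 'l)) set" where
  "param_set = {(a, b). prob_vec a \<and> prob_vec b}"

definition mixture :: "('k \<Rightarrow> real ^ 'x) \<Rightarrow> real ^ 'k \<Rightarrow> real ^ 'x" where
  "mixture \<mu> a = (\<Sum>k\<in>UNIV. (a $ k) *\<^sub>R \<mu> k)"

definition block_vec :: "real ^ 'x \<Rightarrow> real ^ 'y \<Rightarrow> real ^ ('x + 'y)" where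
  "block_vec u v = (\<chi> s. case s of Inl i \<Rightarrow> u $ i | Inr j \<Rightarrow> v $ j)"

definition block_diag :: "real ^ 'n ^ 'x \<Rightarrow> real ^ 'm ^ 'y \<Rightarrow> real ^ ('n + 'm) ^ ('x + 'y)" where
  "block_diag U V = (\<chi> s t. case (s, t) of
       (Inl i, Inl a) \<Rightarrow> U $ i $ a
     | (Inr j, Inr b) \<Rightarrow> V $ j $ b
     | _ \<Rightarrow> 0)"

definition vec_of_mat :: "real ^ 'y ^ 'x \<Rightarrow> real ^ ('x \<times> 'y)" where
  "vec_of_mat P = (\<chi> q. P $ fst q $ snd q)"

definition cost_vec :: "('x::finite \<Rightarrow> 'y::finite \<Rightarrow> real) \<Rightarrow> real ^ ('x \<times> 'y)" where
  "cost_vec c = vec_of_mat (\<chi> i j. c i j)"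

definition marginal_matrix :: "real ^ ('x::finite \<times> 'y::finite) ^ ('x + 'y)" where
  "marginal_matrix = (\<chi> s q. case s of
       Inl i \<Rightarrow> (if fst q = i then 1 else 0)
     | Inr j \<Rightarrow> (if snd q = j then 1 else 0))"

lemma marginal_matrix_Inl:
  fixes P :: "real ^ 'y ^ 'x"
  shows "(marginal_matrix *v vec_of_mat P) $ Inl i = (\<Sum>j\<in>UNIV. P $ i $ j)"
proof -
  have "(marginal_matrix *v vec_of_mat P) $ Inl i
      = (\<Sum>q\<in>UNIV \<times> UNIV. (if fst q = i then 1 else 0) * P $ fst q $ snd q)"
    by (simp add: matrix_vector_mult_def marginal_matrix_def vec_of_mat_def)
  also have "\<dots> = (\<Sum>i'\<in>UNIV. \<Sum>j\<in>UNIV. (if i' = i then 1 else 0) * P $ i' $ j)"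
    by (subst sum.cartesian_product) (simp add: case_prod_unfold)
  also have "\<dots> = (\<Sum>i'\<in>UNIV. if i' = i then \<Sum>j\<in>UNIV. P $ i' $ j else 0)"
    by (intro sum.cong) auto
  finally show ?thesis by simp
qed

lemma marginal_matrix_Inr:
  fixes P :: "real ^ 'y ^ 'x"
  shows "(marginal_matrix *v vec_of_mat P) $ Inr j = (\<Sum>i\<in>UNIV. P $ i $ j)"
proof -
  have "(marginal_matrix *v vec_of_mat P) $ Inr j
      = (\<Sum>q\<in>UNIV \<times> UNIV. (if snd q = j then 1 else 0) * P $ fst q $ snd q)"
    by (simp add: matrix_vector_mult_def marginal_matrix_def vec_of_mat_def)
  also have "\<dots> = (\<Sum>i\<in>UNIV. \<Sum>j'\<in>UNIV. (if j' = j then 1 else 0) * P $ i $ j')"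
    by (subst sum.cartesian_product) (simp add: case_prod_unfold)
  also have "\<dots> = (\<Sum>i\<in>UNIV. \<Sum>j'\<in>UNIV. if j' = j then P $ i $ j' else 0)"
    by (intro sum.cong) auto
  finally show ?thesis by simp
qed

definition marginals ::
  "('k \<Rightarrow> real ^ 'x) \<Rightarrow> ('l \<Rightarrow> real ^ 'y) \<Rightarrow> (real ^ 'k) \<times> (real ^ 'l) \<Rightarrow> real ^ ('x + 'y)" where
  "marginals \<mu> \<nu> \<alpha> = block_vec (mixture \<mu> (fst \<alpha>)) (mixture \<nu> (snd \<alpha>))"

text \<open>
  Optimal values are taken in the extended reals, so that an infeasible problem has value \<open>\<infinity>\<close>, an
  unbounded one \<open>-\<infinity>\<close>, and in both cases there is no solution.
\<close>

definition hf_feasible ::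
  "('k \<Rightarrow> real ^ 'x) \<Rightarrow> ('l \<Rightarrow> real ^ 'y) \<Rightarrow> (real ^ 'k) \<times> (real ^ 'l) \<Rightarrow> (real ^ ('x \<times> 'y)) set" where
  "hf_feasible \<mu> \<nu> \<alpha> = {\<pi>. nonneg_vec \<pi> \<and> marginal_matrix *v \<pi> = marginals \<mu> \<nu> \<alpha>}"

definition hf_value ::
  "('x \<Rightarrow> 'y \<Rightarrow> real) \<Rightarrow> ('k \<Rightarrow> real ^ 'x) \<Rightarrow> ('l \<Rightarrow> real ^ 'y) \<Rightarrow> (real ^ 'k) \<times> (real ^ 'l) \<Rightarrow> ereal" where
  "hf_value c \<mu> \<nu> \<alpha> = (INF \<pi>\<in>hf_feasible \<mu> \<nu> \<alpha>. ereal (\<pi> \<bullet> cost_vec c))"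

definition hf_solution ::
  "('x \<Rightarrow> 'y \<Rightarrow> real) \<Rightarrow> ('k \<Rightarrow> real ^ 'x) \<Rightarrow> ('l \<Rightarrow> real ^ 'y) \<Rightarrow> (real ^ 'k) \<times> (real ^ 'l)
    \<Rightarrow> real ^ ('x \<times> 'y) \<Rightarrow> bool" where
  "hf_solution c \<mu> \<nu> \<alpha> \<pi> \<longleftrightarrow>
     \<pi> \<in> hf_feasible \<mu> \<nu> \<alpha> \<and> ereal (\<pi> \<bullet> cost_vec c) = hf_value c \<mu> \<nu> \<alpha>"

definition snapshot_matrix :: "('r \<Rightarrow> real ^ 'q) \<Rightarrow> real ^ 'r ^ 'q" where
  "snapshot_matrix \<pi>s = (\<chi> q r. \<pi>s r $ q)"

definition snapshot_cone :: "real ^ 'r ^ 'q \<Rightarrow> (real ^ 'q) set" where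
  "snapshot_cone W = {W *v p | p. nonneg_vec p}"

definition rp_feasible ::
  "('k \<Rightarrow> real ^ 'x) \<Rightarrow> ('l \<Rightarrow> real ^ 'y) \<Rightarrow> real ^ 'r ^ ('x \<times> 'y)
    \<Rightarrow> real ^ 'n ^ 'x \<Rightarrow> real ^ 'm ^ 'y \<Rightarrow> (real ^ 'k) \<times> (real ^ 'l) \<Rightarrow> (real ^ 'r) set" where
  "rp_feasible \<mu> \<nu> W U V \<alpha> =
     {p. nonneg_vec p \<and>
         (transpose (block_diag U V) ** marginal_matrix ** W) *v p
           = transpose (block_diag U V) *v marginals \<mu> \<nu> \<alpha>}"

definition rp_value ::
  "('x \<Rightarrow> 'y \<Rightarrow> real) \<Rightarrow> ('k \<Rightarrow> real ^ 'x) \<Rightarrow> ('l \<Rightarrow> real ^ 'y) \<Rightarrow> real ^ 'r ^ ('x \<times> 'y)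
    \<Rightarrow> real ^ 'n ^ 'x \<Rightarrow> real ^ 'm ^ 'y \<Rightarrow> (real ^ 'k) \<times> (real ^ 'l) \<Rightarrow> ereal" where
  "rp_value c \<mu> \<nu> W U V \<alpha> =
     (INF p\<in>rp_feasible \<mu> \<nu> W U V \<alpha>. ereal (p \<bullet> (transpose W *v cost_vec c)))"

definition rp_solution ::
  "('x \<Rightarrow> 'y \<Rightarrow> real) \<Rightarrow> ('k \<Rightarrow> real ^ 'x) \<Rightarrow> ('l \<Rightarrow> real ^ 'y) \<Rightarrow> real ^ 'r ^ ('x \<times> 'y)
    \<Rightarrow> real ^ 'n ^ 'x \<Rightarrow> real ^ 'm ^ 'y \<Rightarrow> (real ^ 'k) \<times> (real ^ 'l) \<Rightarrow> real ^ 'r \<Rightarrow> bool" where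
  "rp_solution c \<mu> \<nu> W U V \<alpha> p \<longleftrightarrow>
     p \<in> rp_feasible \<mu> \<nu> W U V \<alpha> \<and>
     ereal (p \<bullet> (transpose W *v cost_vec c)) = rp_value c \<mu> \<nu> W U V \<alpha>"

end

theory Submission
  imports Defs
begin

text \<open>
  The marginals of \<open>W p\<close> depend linearly on \<open>p\<close>, so the parameters whose marginals are reproduced
  exactly by some \<open>W p\<close> with \<open>p \<ge> 0\<close> form a convex set. It contains the extreme points of the
  compact convex set \<open>param_set\<close>, hence all of it by Krein--Milman, and the reduced problem is
  feasible. The all-ones column tests the reduced constraint against total mass; as every snapshot
  has mass one, feasible \<open>p\<close> lie in the probability simplex. The feasible set is thus compact and the
  linear objective attains its minimum.
\<close>

lemma convex_prob_vec: "convex {v :: real ^ 'n. prob_vec v}"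
proof (rule convexI)
  fix v w :: "real ^ 'n" and s t :: real
  assume "v \<in> {v. prob_vec v}" "w \<in> {v. prob_vec v}" and st: "0 \<le> s" "0 \<le> t" "s + t = 1"
  then show "s *\<^sub>R v + t *\<^sub>R w \<in> {v. prob_vec v}"
    by (auto simp: prob_vec_def nonneg_vec_def sum.distrib sum_distrib_left[symmetric])
qed

lemma closed_nonneg_vec: "closed {v :: real ^ 'n. nonneg_vec v}"
  unfolding nonneg_vec_def by (intro closed_Collect_all closed_Collect_le continuous_intros)

text \<open>Used twice: through products it makes \<open>param_set\<close> compact for Krein-Milman,
  and it is the compact set enclosing the reduced feasible set.\<close>

lemma compact_prob_vec: "compact {v :: real ^ 'n. prob_vec v}"
proof -
  have "closed {v :: real ^ 'n. prob_vec v}"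
    unfolding prob_vec_def
    by (intro closed_Collect_conj closed_nonneg_vec closed_Collect_eq continuous_intros)
  \<comment> \<open>For nonnegative entries the l1 norm is the sum of the entries, here 1, and it
    dominates the Euclidean norm.\<close>
  moreover have "norm v \<le> 1" if "prob_vec v" for v :: "real ^ 'n"
    using norm_le_l1_cart[of v] that by (simp add: prob_vec_def nonneg_vec_def)
  then have "bounded {v :: real ^ 'n. prob_vec v}"
    by (auto simp: bounded_iff)
  ultimately show ?thesis
    by (simp add: compact_eq_bounded_closed)
qed

lemma param_set_Times: "param_set = {a. prob_vec a} \<times> {b. prob_vec b}"
  by (auto simp: param_set_def)

lemma linear_marginals: "linear (marginals \<mu> \<nu>)"
proof (rule linearI)
  fix \<alpha> \<beta> :: "(real ^ 'a) \<times> (real ^ 'b)"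
  show "marginals \<mu> \<nu> (\<alpha> + \<beta>) = marginals \<mu> \<nu> \<alpha> + marginals \<mu> \<nu> \<beta>"
    by (simp add: vec_eq_iff marginals_def block_vec_def mixture_def scaleR_add_left sum.distrib
        split: sum.split)
next
  fix r :: real and \<alpha> :: "(real ^ 'a) \<times> (real ^ 'b)"
  show "marginals \<mu> \<nu> (r *\<^sub>R \<alpha>) = r *\<^sub>R marginals \<mu> \<nu> \<alpha>"
    by (simp add: vec_eq_iff marginals_def block_vec_def mixture_def sum_distrib_left
        mult.assoc split: sum.split)
qed

lemma prob_vec_mixture:
  assumes "\<And>k. prob_vec (\<mu> k)" and "prob_vec a"
  shows "prob_vec (mixture \<mu> a)"
proof -
  have "(\<Sum>i\<in>UNIV. mixture \<mu> a $ i) = (\<Sum>k\<in>UNIV. \<Sum>i\<in>UNIV. a $ k * \<mu> k $ i)"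
    unfolding mixture_def by (subst sum.swap) simp
  also have "\<dots> = (\<Sum>k\<in>UNIV. a $ k)"
    using assms(1) by (simp add: sum_distrib_left[symmetric] prob_vec_def)
  finally show ?thesis
    using assms by (auto simp: prob_vec_def nonneg_vec_def mixture_def intro!: sum_nonneg)
qed

text \<open>Mixing probability vectors with weights of sum 1 preserves total mass. Both blocks are
  recorded because the all-ones column may sit in \<open>U\<close> or in \<open>V\<close>.\<close>

lemma marginals_mass:
  assumes "\<And>k. prob_vec (\<mu> k)" "\<And>l. prob_vec (\<nu> l)" and "\<alpha> \<in> param_set"
  shows "(\<Sum>i\<in>UNIV. marginals \<mu> \<nu> \<alpha> $ Inl i) = 1" "(\<Sum>j\<in>UNIV. marginals \<mu> \<nu> \<alpha> $ Inr j) = 1"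
  using assms prob_vec_mixture[of \<mu> "fst \<alpha>"] prob_vec_mixture[of \<nu> "snd \<alpha>"]
  by (auto simp: marginals_def block_vec_def prob_vec_def param_set_def)

lemma sum_UNIV_Plus:
  "(\<Sum>s\<in>UNIV. f s) = (\<Sum>i\<in>UNIV. f (Inl i)) + (\<Sum>j\<in>UNIV. f (Inr j))"
  for f :: "'a::finite + 'b::finite \<Rightarrow> 'c::comm_monoid_add"
  by (simp add: sum.Plus flip: UNIV_Plus_UNIV del: UNIV_Plus_UNIV)

text \<open>Phrased with \<open>v*\<close> because the simplifier rewrites
  \<open>transpose A *v w\<close> to \<open>w v* A\<close>.\<close>

lemma vector_block_diag_mult:
  shows "(w v* block_diag U V) $ Inl a = (\<Sum>i\<in>UNIV. w $ Inl i * U $ i $ a)"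
    and "(w v* block_diag U V) $ Inr b = (\<Sum>j\<in>UNIV. w $ Inr j * V $ j $ b)"
  by (simp_all add: vector_matrix_mult_def block_diag_def sum_UNIV_Plus mult.commute)

text \<open>The product with \<open>snapshot_matrix\<close> is the combination of the snapshots with
  coefficients \<open>p\<close>, and feasibility of each snapshot fixes its marginals.\<close>

lemma marginals_snapshot_mult:
  assumes "\<And>r. \<pi>s r \<in> hf_feasible \<mu> \<nu> (\<alpha>s r)"
  shows "marginal_matrix *v (snapshot_matrix \<pi>s *v p) = (\<Sum>r\<in>UNIV. p $ r *\<^sub>R marginals \<mu> \<nu> (\<alpha>s r))"
proof -
  have "column r (snapshot_matrix \<pi>s) = \<pi>s r" for r
    by (simp add: vec_eq_iff column_def snapshot_matrix_def)
  then have "snapshot_matrix \<pi>s *v p = (\<Sum>r\<in>UNIV. p $ r *\<^sub>R \<pi>s r)"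
    by (simp add: matrix_mult_sum scalar_mult_eq_scaleR)
  then show ?thesis
    using assms by (simp add: linear_sum[OF matrix_vector_mul_linear] matrix_vector_mult_scaleR
        hf_feasible_def)
qed

lemma rp_feasible_prob_vec:
  assumes \<mu>\<nu>: "\<And>k. prob_vec (\<mu> k)" "\<And>l. prob_vec (\<nu> l)"
    and \<alpha>s: "\<And>r. \<alpha>s r \<in> param_set" and \<pi>s: "\<And>r. \<pi>s r \<in> hf_feasible \<mu> \<nu> (\<alpha>s r)"
    and ones: "(\<chi> i. 1) \<in> columns U \<or> (\<chi> j. 1) \<in> columns V"
    and \<alpha>: "\<alpha> \<in> param_set" and p: "p \<in> rp_feasible \<mu> \<nu> (snapshot_matrix \<pi>s) U V \<alpha>"
  shows "prob_vec p"
proof -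
  define w where "w = marginal_matrix *v (snapshot_matrix \<pi>s *v p)"
  have eq: "transpose (block_diag U V) *v w = transpose (block_diag U V) *v marginals \<mu> \<nu> \<alpha>"
    using p by (simp add: rp_feasible_def w_def flip: matrix_vector_mul_assoc)
  have w: "w = (\<Sum>r\<in>UNIV. p $ r *\<^sub>R marginals \<mu> \<nu> (\<alpha>s r))"
    unfolding w_def using \<pi>s by (rule marginals_snapshot_mult)
  note mass = marginals_mass[OF \<mu>\<nu>]
  \<comment> \<open>After exchanging the sums, each snapshot contributes its mass 1 times
    \<open>p $ r\<close>.\<close>
  have wl: "(\<Sum>i\<in>UNIV. w $ Inl i) = (\<Sum>r\<in>UNIV. p $ r)"
    unfolding w sum_component by (subst sum.swap) (simp add: sum_distrib_left[symmetric] mass \<alpha>s)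
  have wr: "(\<Sum>j\<in>UNIV. w $ Inr j) = (\<Sum>r\<in>UNIV. p $ r)"
    unfolding w sum_component by (subst sum.swap) (simp add: sum_distrib_left[symmetric] mass \<alpha>s)
  from ones have "(\<Sum>r\<in>UNIV. p $ r) = 1"
  proof
    assume "(\<chi> i. 1) \<in> columns U"
    then obtain a where "\<And>i. U $ i $ a = 1"
      by (auto simp: columns_def column_def vec_eq_iff)
    then show ?thesis
      \<comment> \<open>The component at the all-ones column equates the masses of the first blocks:
        the sum of \<open>p\<close> on the left, 1 on the right.\<close>
      using arg_cong[OF eq, of "\<lambda>z. z $ Inl a"] by (simp add: vector_block_diag_mult wl mass \<alpha>)
  next
    assume "(\<chi> j. 1) \<in> columns V"
    then obtain b where "\<And>j. V $ j $ b = 1"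
      by (auto simp: columns_def column_def vec_eq_iff)
    then show ?thesis
      using arg_cong[OF eq, of "\<lambda>z. z $ Inr b"] by (simp add: vector_block_diag_mult wr mass \<alpha>)
  qed
  then show ?thesis
    using p by (simp add: prob_vec_def rp_feasible_def)
qed

lemma closed_rp_feasible: "closed (rp_feasible \<mu> \<nu> W U V \<alpha>)"
  unfolding rp_feasible_def
  by (intro closed_Collect_conj closed_nonneg_vec closed_Collect_eq continuous_on_const
      linear_continuous_on linear_linear[THEN iffD2] matrix_vector_mul_linear)

text \<open>The equation is linear in \<open>p\<close> on one side and in \<alpha> on the other, and
  nonnegative vectors form a convex cone. Combining the two coefficient vectors with the same
  weights therefore gives a witness.\<close>

lemma convex_reproduced_params:
  "convex {\<alpha>. \<exists>p. nonneg_vec p \<and> marginal_matrix *v (W *v p) = marginals \<mu> \<nu> \<alpha>}"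
proof (rule convexI)
  fix \<alpha> \<beta> and s t :: real
  assume "\<alpha> \<in> {\<alpha>. \<exists>p. nonneg_vec p \<and> marginal_matrix *v (W *v p) = marginals \<mu> \<nu> \<alpha>}"
    and "\<beta> \<in> {\<alpha>. \<exists>p. nonneg_vec p \<and> marginal_matrix *v (W *v p) = marginals \<mu> \<nu> \<alpha>}"
    and st: "0 \<le> s" "0 \<le> t"
  then obtain p q where pq: "nonneg_vec p" "nonneg_vec q"
      "marginal_matrix *v (W *v p) = marginals \<mu> \<nu> \<alpha>"
      "marginal_matrix *v (W *v q) = marginals \<mu> \<nu> \<beta>"
    by blast
  show "s *\<^sub>R \<alpha> + t *\<^sub>R \<beta> \<in> {\<alpha>. \<exists>p. nonneg_vec p \<and> marginal_matrix *v (W *v p) = marginals \<mu> \<nu> \<alpha>}"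
    using pq st
    by (intro CollectI exI[of _ "s *\<^sub>R p + t *\<^sub>R q"])
      (simp add: nonneg_vec_def matrix_vector_right_distrib matrix_vector_mult_scaleR
        linear_add[OF linear_marginals] linear_scale[OF linear_marginals])
qed

lemma rp_feasible_nonempty:
  fixes \<mu> :: "'k::finite \<Rightarrow> real ^ 'x::finite" and \<nu> :: "'l::finite \<Rightarrow> real ^ 'y::finite"
  assumes ext: "\<And>\<alpha>\<^sub>e. \<alpha>\<^sub>e extreme_point_of (param_set :: ((real ^ 'k) \<times> (real ^ 'l)) set) \<Longrightarrow>
      \<exists>\<pi>. \<pi> \<in> hf_feasible \<mu> \<nu> \<alpha>\<^sub>e \<and> \<pi> \<in> snapshot_cone W"
    and \<alpha>: "\<alpha> \<in> param_set"
  shows "rp_feasible \<mu> \<nu> W U V \<alpha> \<noteq> {}"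
proof -
  let ?E = "{\<alpha>\<^sub>e. \<alpha>\<^sub>e extreme_point_of (param_set :: ((real ^ 'k) \<times> (real ^ 'l)) set)}"
  let ?T = "{\<alpha>. \<exists>p. nonneg_vec p \<and> marginal_matrix *v (W *v p) = marginals \<mu> \<nu> \<alpha>}"
  have "?E \<subseteq> ?T"
    using ext by (fastforce simp: hf_feasible_def snapshot_cone_def)
  then have "convex hull ?E \<subseteq> ?T"
    by (rule hull_minimal) (rule convex_reproduced_params)
  \<comment> \<open>In finite dimension the convex hull of the extreme points is already the whole
    compact convex set, so no closure is taken.\<close>
  moreover have "param_set = convex hull ?E"
    by (rule Krein_Milman_Minkowski)
      (simp_all add: param_set_Times compact_Times convex_Times compact_prob_vec convex_prob_vec)
  ultimately obtain p where "nonneg_vec p" "marginal_matrix *v (W *v p) = marginals \<mu> \<nu> \<alpha>"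
    using \<alpha> by blast
  \<comment> \<open>Multiplying the exact marginal equation by
    \<open>transpose (block_diag U V)\<close> yields the reduced constraint, whatever
    \<open>U\<close> and \<open>V\<close> are.\<close>
  then have "p \<in> rp_feasible \<mu> \<nu> W U V \<alpha>"
    by (simp add: rp_feasible_def flip: matrix_vector_mul_assoc)
  then show ?thesis
    by blast
qed

theorem proposition3p10:
  fixes c :: "'x::finite \<Rightarrow> 'y::finite \<Rightarrow> real"
    and \<mu> :: "'k::finite \<Rightarrow> real ^ 'x" and \<nu> :: "'l::finite \<Rightarrow> real ^ 'y"
    and \<alpha>s :: "'r::finite \<Rightarrow> (real ^ 'k) \<times> (real ^ 'l)"
    and \<pi>s :: "'r \<Rightarrow> real ^ ('x \<times> 'y)"
    and W :: "real ^ 'r ^ ('x \<times> 'y)"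
    and U :: "real ^ 'n::finite ^ 'x" and V :: "real ^ 'm::finite ^ 'y"
  assumes "\<And>i j. 0 \<le> c i j"
    and "\<And>k. prob_vec (\<mu> k)" and "\<And>l. prob_vec (\<nu> l)"
    and "\<And>r. \<alpha>s r \<in> param_set"
    and "\<And>r. hf_solution c \<mu> \<nu> (\<alpha>s r) (\<pi>s r)"
    and "W = snapshot_matrix \<pi>s"
    and "\<And>\<alpha>\<^sub>e. \<alpha>\<^sub>e extreme_point_of (param_set :: ((real ^ 'k) \<times> (real ^ 'l)) set) \<Longrightarrow>
           \<exists>\<pi>. hf_solution c \<mu> \<nu> \<alpha>\<^sub>e \<pi> \<and> \<pi> \<in> snapshot_cone W"
    and "(\<chi> i. 1) \<in> columns U \<or> (\<chi> j. 1) \<in> columns V"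
  shows "\<forall>\<alpha>\<in>param_set. \<exists>p. rp_solution c \<mu> \<nu> W U V \<alpha> p"
proof
  fix \<alpha> :: "(real ^ 'k) \<times> (real ^ 'l)"
  assume \<alpha>: "\<alpha> \<in> param_set"
  let ?F = "rp_feasible \<mu> \<nu> W U V \<alpha>"
  let ?f = "\<lambda>p. p \<bullet> (transpose W *v cost_vec c)"
  have \<pi>s: "\<pi>s r \<in> hf_feasible \<mu> \<nu> (\<alpha>s r)" for r
    using assms(5) by (simp add: hf_solution_def)
  have "?F \<subseteq> {p. prob_vec p}"
    using rp_feasible_prob_vec[OF assms(2,3,4) \<pi>s assms(8) \<alpha>] by (auto simp: assms(6))
  then have "compact ?F"
    using compact_Int_closed[OF compact_prob_vec closed_rp_feasible[of \<mu> \<nu> W U V \<alpha>]]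
    by (simp add: Int_absorb1)
  moreover have "?F \<noteq> {}"
    using assms(7) \<alpha> by (intro rp_feasible_nonempty) (auto simp: hf_solution_def)
  moreover have "continuous_on ?F ?f"
    by (intro continuous_intros)
  ultimately obtain p where p: "p \<in> ?F" and min: "\<And>q. q \<in> ?F \<Longrightarrow> ?f p \<le> ?f q"
    using continuous_attains_inf[of ?F ?f] by blast
  \<comment> \<open>A real minimum attained at a feasible \<open>p\<close> is also the infimum in
    the extended reals.\<close>
  have "rp_value c \<mu> \<nu> W U V \<alpha> = ereal (?f p)"
    unfolding rp_value_def by (rule INF_eqI) (use p min in auto)
  then show "\<exists>p. rp_solution c \<mu> \<nu> W U V \<alpha> p"
    using p by (auto simp: rp_solution_def)
qed

end
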